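(* Let $n$ be a positive integer and $y\in\mathbb{C}$. Suppose that $F$ and $G$ are two entire functions with no common zeros which satisfy the functional equations $$F(z)=F(z+\pi)=q^{n/2}e^{2inz+2iy}F(z+\pi\tau)$$ and $$G(z)=-G(z+\pi)=-q^{n/2}e^{2inz}G(z+\pi\tau).$$ Suppose further that $G$ has only simple zeros and that $\mathcal{P}=\{a_1,a_2,\ldots,a_n\}$ is a complete set of inequivalent zeros of $G$. Then $$\frac{F(z)\,\theta_3(y|\tau)}{\theta_1'(0|\tau)\,G(z)}=\sum_{k=1}^{n}\frac{F(a_k)\,\theta_3(z+y-a_k|\tau)}{G'(a_k)\,\theta_1(z-a_k|\tau)}.$$
   Context: Fix $\tau\in\mathbb{C}$ with $\mathrm{Im}\,\tau>0$ and put $q=e^{2\pi i\tau}$, with $q^{s}=e^{2\pi i s\tau}$. The Jacobi theta functions used are the entire functions $\theta_1(z|\tau)=2\sum_{n=0}^\infty(-1)^n q^{(2n+1)^2/8}\sin((2n+1)z)$ and $\theta_3(z|\tau)=1+2\sum_{n=1}^\infty q^{n^2/2}\cos(2nz)$; a prime denotes the derivative with respect to the (first) variable $z$. Let $\Lambda=\{m\pi+l\pi\tau:(m,l)\in\mathbb{Z}^2\}$. Two complex numbers are equivalent if their difference lies in $\Lambda$ and inequivalent otherwise. A complete set of inequivalent zeros of $G$ is a set of pairwise inequivalent zeros such that every zero of $G$ is equivalent to one of them. The identity is one of meromorphic functions of $z$. *)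

theory Defs
  imports "HOL-Complex_Analysis.Complex_Analysis"
begin

text \<open>\<open>nome_pow \<tau> s\<close> is \<open>q\<^sup>s\<close> for \<open>q = exp (2\<pi>i\<tau>)\<close>, with the branch fixed by
  \<open>q\<^sup>s = exp (2\<pi>is\<tau>)\<close>. It is not \<open>q powr s\<close>, which uses the principal logarithm of \<open>q\<close>.\<close>

definition nome_pow :: "complex \<Rightarrow> real \<Rightarrow> complex" where
  "nome_pow \<tau> s = exp (2 * of_real pi * \<i> * of_real s * \<tau>)"

definition theta1 :: "complex \<Rightarrow> complex \<Rightarrow> complex" where
  "theta1 z \<tau> = 2 * (\<Sum>n. (- 1) ^ n * nome_pow \<tau> ((2 * real n + 1)\<^sup>2 / 8)
                          * sin ((2 * of_nat n + 1) * z))"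

text \<open>The series for \<open>\<theta>\<^sub>3\<close> runs over \<open>n \<ge> 1\<close>, hence the index shift by \<open>Suc\<close>.\<close>

definition theta3 :: "complex \<Rightarrow> complex \<Rightarrow> complex" where
  "theta3 z \<tau> = 1 + 2 * (\<Sum>n. nome_pow \<tau> ((real (Suc n))\<^sup>2 / 2) * cos (2 * of_nat (Suc n) * z))"

definition period_lattice :: "complex \<Rightarrow> complex set" where
  "period_lattice \<tau> = {of_int m * of_real pi + of_int l * of_real pi * \<tau> | m l :: int. True}"

definition equivalent :: "complex \<Rightarrow> complex \<Rightarrow> complex \<Rightarrow> bool" where
  "equivalent \<tau> z w \<longleftrightarrow> z - w \<in> period_lattice \<tau>"

definition complete_inequivalent_zeros :: "complex \<Rightarrow> (complex \<Rightarrow> complex) \<Rightarrow> complex set \<Rightarrow> bool" where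
  "complete_inequivalent_zeros \<tau> G P \<longleftrightarrow>
     (\<forall>a\<in>P. G a = 0) \<and>
     (\<forall>a\<in>P. \<forall>b\<in>P. a \<noteq> b \<longrightarrow> \<not> equivalent \<tau> a b) \<and>
     (\<forall>z. G z = 0 \<longrightarrow> (\<exists>a\<in>P. equivalent \<tau> z a))"

end

theory Submission
  imports Defs
begin

text \<open>For fixed \<open>z\<close>, the function
  \<open>f w = F w * \<theta>\<^sub>3 (z + y - w) / (G w * \<theta>\<^sub>1 (z - w))\<close> is elliptic in \<open>w\<close>. Modulo the lattice its
  poles are the zeros \<open>a\<^sub>k\<close> of \<open>G\<close>, whose residues are the terms of the right-hand side, and \<open>z\<close>,
  whose residue is minus the left-hand side. The identity says that the residues add up to zero.

  This uses that the zeros of \<open>\<theta>\<^sub>1\<close> are exactly the lattice points and that the zero at \<open>0\<close> is simple: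
  \<open>exp (i z) * \<theta>\<^sub>1 z\<close> and \<open>E (exp (2 i z)) * E (q * exp (- 2 i z))\<close>, where \<open>E\<close> is the Euler
  product, have the same multipliers under the two periods, so by Liouville they are proportional.\<close>

section \<open>Simple poles and removable singularities\<close>

text \<open>One notion covers simple poles and removable singularities: \<open>r\<close> is the
  residue, and \<open>r = 0\<close> means removable. Only a punctured neighbourhood of
  \<open>p\<close> is inspected, so the values that division by zero assigns at poles do no
  harm.\<close>

definition has_polar_part :: "(complex \<Rightarrow> complex) \<Rightarrow> complex \<Rightarrow> complex \<Rightarrow> bool" where
  "has_polar_part g r p \<longleftrightarrow>
     (\<exists>h. h analytic_on {p} \<and> (\<forall>\<^sub>F w in at p. g w = r / (w - p) + h w))"

lemma has_polar_part_analytic: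
  assumes "g analytic_on {p}"
  shows "has_polar_part g 0 p"
  unfolding has_polar_part_def using assms by (intro exI[of _ g]) auto

lemma has_polar_part_cong:
  assumes "\<forall>\<^sub>F w in at p. f w = g w"
  shows "has_polar_part f r p \<longleftrightarrow> has_polar_part g r p"
proof -
  have "has_polar_part g r p" if "has_polar_part f r p" "\<forall>\<^sub>F w in at p. f w = g w" for f g
  proof -
    from that(1) obtain h where h: "h analytic_on {p}" "\<forall>\<^sub>F w in at p. f w = r / (w - p) + h w"
      unfolding has_polar_part_def by blast
    from h(2) that(2) have "\<forall>\<^sub>F w in at p. g w = r / (w - p) + h w"
      by eventually_elim simp
    with h(1) show ?thesis
      unfolding has_polar_part_def by blast
  qed
  from this[of f g] this[of g f] assms show ?thesis
    by (auto simp: eq_commute)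
qed

lemma has_polar_part_add:
  assumes "has_polar_part f r p" "has_polar_part g s p"
  shows "has_polar_part (\<lambda>w. f w + g w) (r + s) p"
proof -
  from assms obtain h k where h: "h analytic_on {p}" "\<forall>\<^sub>F w in at p. f w = r / (w - p) + h w"
    and k: "k analytic_on {p}" "\<forall>\<^sub>F w in at p. g w = s / (w - p) + k w"
    unfolding has_polar_part_def by blast
  from h(2) k(2) have "\<forall>\<^sub>F w in at p. f w + g w = (r + s) / (w - p) + (h w + k w)"
    by eventually_elim (simp add: add_divide_distrib)
  moreover have "(\<lambda>w. h w + k w) analytic_on {p}"
    by (intro analytic_intros h k)
  ultimately show ?thesis
    unfolding has_polar_part_def by (intro exI[of _ "\<lambda>w. h w + k w"]) auto
qed

lemma has_polar_part_cmult:
  assumes "has_polar_part f r p"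
  shows "has_polar_part (\<lambda>w. c * f w) (c * r) p"
proof -
  from assms obtain h where h: "h analytic_on {p}" "\<forall>\<^sub>F w in at p. f w = r / (w - p) + h w"
    unfolding has_polar_part_def by blast
  from h(2) have "\<forall>\<^sub>F w in at p. c * f w = (c * r) / (w - p) + c * h w"
    by eventually_elim (simp add: ring_distribs)
  moreover have "(\<lambda>w. c * h w) analytic_on {p}"
    by (intro analytic_intros h)
  ultimately show ?thesis
    unfolding has_polar_part_def by (intro exI[of _ "\<lambda>w. c * h w"]) auto
qed

lemma has_polar_part_diff:
  assumes "has_polar_part f r p" "has_polar_part g s p"
  shows "has_polar_part (\<lambda>w. f w - g w) (r - s) p"
  using has_polar_part_add[OF assms(1) has_polar_part_cmult[OF assms(2), of "-1"]] by simp

lemma has_polar_part_sum: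
  assumes "\<And>i. i \<in> I \<Longrightarrow> has_polar_part (f i) (r i) p"
  shows "has_polar_part (\<lambda>w. \<Sum>i\<in>I. f i w) (\<Sum>i\<in>I. r i) p"
  using assms
  by (induction I rule: infinite_finite_induct)
     (auto intro: has_polar_part_add has_polar_part_analytic)

text \<open>For a period \<open>d\<close> this moves polar parts between equivalent points. The
  converse is the forward direction with \<open>- d\<close>.\<close>

lemma has_polar_part_shift:
  "has_polar_part g r (p + d) \<longleftrightarrow> has_polar_part (\<lambda>w. g (w + d)) r p"
proof -
  have *: "has_polar_part (\<lambda>w. g (w + d)) r p" if "has_polar_part g r (p + d)" for g p d
  proof -
    from that obtain h where h: "h analytic_on {p + d}"
        "\<forall>\<^sub>F w in at (p + d). g w = r / (w - (p + d)) + h w"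
      unfolding has_polar_part_def by blast
    have "h \<circ> (\<lambda>w. w + d) analytic_on {p}"
      by (rule analytic_on_compose) (auto intro!: analytic_intros h)
    moreover have "at (p + d) = filtermap (\<lambda>w. w + d) (at p)"
      using filtermap_at_shift[of "-d" p] by simp
    hence "\<forall>\<^sub>F w in at p. g (w + d) = r / (w - p) + (h \<circ> (\<lambda>w. w + d)) w"
      using h(2) by (simp add: eventually_filtermap)
    ultimately show ?thesis
      unfolding has_polar_part_def by blast
  qed
  show ?thesis
    using *[of g p d] *[of "\<lambda>w. g (w + d)" "p + d" "-d"] by auto
qed

text \<open>The difference quotient, completed at \<open>p\<close> by the derivative, is holomorphic
  because the singularity is removable.\<close>

lemma analytic_at_factor:
  assumes "f analytic_on {p}"
  obtains h where "h analytic_on {p}" "h p = deriv f p" "\<forall>\<^sub>F w in at p. f w = f p + (w - p) * h w"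
proof -
  from assms obtain S where S: "open S" "p \<in> S" "f holomorphic_on S"
    by (auto simp: analytic_at)
  define h where "h = (\<lambda>z. if z = p then deriv f p else (f z - f p) / (z - p))"
  have "h holomorphic_on S"
    unfolding h_def using S by (intro pole_lemma_open)
  with S have "h analytic_on {p}"
    by (auto simp: analytic_at)
  moreover have "\<forall>\<^sub>F w in at p. f w = f p + (w - p) * h w"
    by (auto simp: eventually_at_filter h_def)
  ultimately show ?thesis
    using that[of h] by (simp add: h_def)
qed

text \<open>Writing \<open>g w = (w - p) * h w\<close> reduces the claim to the first-order
  expansion of \<open>f / h\<close> at \<open>p\<close>. If \<open>f p = 0\<close>, the singularity
  is removable.\<close>

lemma has_polar_part_divide:
  assumes f: "f analytic_on {p}" and g: "g analytic_on {p}" and "g p = 0" "deriv g p \<noteq> 0"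
  shows "has_polar_part (\<lambda>w. f w / g w) (f p / deriv g p) p"
proof -
  obtain h where h: "h analytic_on {p}" "h p = deriv g p"
      "\<forall>\<^sub>F w in at p. g w = g p + (w - p) * h w"
    using analytic_at_factor[OF g] by blast
  have "(\<lambda>w. f w / h w) analytic_on {p}"
    using assms h by (intro analytic_intros) auto
  then obtain k where k: "k analytic_on {p}"
      "\<forall>\<^sub>F w in at p. f w / h w = f p / h p + (w - p) * k w"
    using analytic_at_factor by blast
  have "\<forall>\<^sub>F w in at p. w \<noteq> p"
    by (simp add: eventually_at_filter)
  with h(3) k(2) have "\<forall>\<^sub>F w in at p. f w / g w = (f p / deriv g p) / (w - p) + k w"
  proof eventually_elim
    case (elim w)
    have "f w / g w = (f w / h w) / (w - p)"
      using elim(1) \<open>g p = 0\<close> by (simp add: mult_ac)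
    also have "\<dots> = (f p / h p) / (w - p) + k w"
      unfolding elim(2) using elim(3) by (simp add: add_divide_distrib)
    finally show ?case
      by (simp add: h(2))
  qed
  with k(1) show ?thesis
    unfolding has_polar_part_def by blast
qed

text \<open>All local continuations are given by the limit of \<open>g\<close>, hence they glue. The
  conclusion speaks of limits because the values of \<open>g\<close> at isolated points may be
  wrong.\<close>

lemma entire_extension:
  assumes "\<And>p. has_polar_part g 0 p"
  obtains H where "H holomorphic_on UNIV" "\<And>p. g \<midarrow>p\<rightarrow> H p"
proof -
  have *: "\<exists>h. h analytic_on {p} \<and> (\<forall>\<^sub>F w in at p. g w = h w)" for p
    using assms[of p] unfolding has_polar_part_def by simp
  define H where "H = (\<lambda>p. Lim (at p) g)"
  have lim: "g \<midarrow>p\<rightarrow> h p" if "h analytic_on {p}" "\<forall>\<^sub>F w in at p. g w = h w" for h p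
    using tendsto_cong[OF that(2)] analytic_at_imp_isCont[OF that(1)] by (simp add: isCont_def)
  have H: "H p = h p" if "h analytic_on {p}" "\<forall>\<^sub>F w in at p. g w = h w" for h p
    unfolding H_def by (rule tendsto_Lim[OF _ lim[OF that]]) simp
  have "g \<midarrow>p\<rightarrow> H p" for p
    using *[of p] lim[of _ p] H[of _ p] by metis
  moreover have "H analytic_on {p}" for p
  proof -
    obtain h where h: "h analytic_on {p}" "\<forall>\<^sub>F w in at p. g w = h w"
      using *[of p] by blast
    from h(1) obtain S where S: "open S" "p \<in> S" "h holomorphic_on S"
      by (auto simp: analytic_at)
    from h(2) obtain T where T: "open T" "p \<in> T" "\<And>w. w \<in> T \<Longrightarrow> w \<noteq> p \<Longrightarrow> g w = h w"
      by (auto simp: eventually_at_topological)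
    \<comment> \<open>For \<open>w\<close> other than \<open>p\<close>, the same \<open>h\<close>
      continues \<open>g\<close> around \<open>w\<close>, so \<open>H\<close> agrees with
      \<open>h\<close> on a whole neighbourhood of \<open>p\<close>.\<close>
    have "H w = h w" if w: "w \<in> S \<inter> T" for w
    proof (cases "w = p")
      case False
      have "\<forall>\<^sub>F u in at w. u \<in> T - {p}"
        using T(1) w False by (intro eventually_at_in_open') auto
      hence "\<forall>\<^sub>F u in at w. g u = h u"
        by eventually_elim (use T(3) in auto)
      moreover have "h analytic_on {w}"
        using S w by (auto simp: analytic_at)
      ultimately show ?thesis
        using H by blast
    qed (use H h in blast)
    hence "H holomorphic_on (S \<inter> T)"
      using S(3) by (subst holomorphic_cong[OF refl, of _ _ h]) (auto intro: holomorphic_on_subset)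
    with S T show ?thesis
      by (auto simp: analytic_at intro!: exI[of _ "S \<inter> T"])
  qed
  hence "H holomorphic_on UNIV"
    by (metis analytic_imp_holomorphic analytic_on_analytic_at)
  ultimately show ?thesis
    using that by blast
qed

section \<open>Quasi-periodic entire functions\<close>

text \<open>Stated for a predicate, so that it transports values, zeros and polar parts along the
  lattice alike.\<close>

lemma equivalent_induct:
  assumes pi: "\<And>z. Q z \<longleftrightarrow> Q (z + of_real pi)"
    and tau: "\<And>z. Q z \<longleftrightarrow> Q (z + of_real pi * \<tau>)"
    and "equivalent \<tau> z w"
  shows "Q z \<longleftrightarrow> Q w"
proof -
  have *: "Q u \<longleftrightarrow> Q (u + of_int m * d)" if "\<And>z. Q z \<longleftrightarrow> Q (z + d)" for m :: int and d u :: complex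
  proof (induction m rule: int_induct[where k = 0])
    case (step1 m)
    thus ?case using that[of "u + of_int m * d"] by (simp add: algebra_simps)
  next
    case (step2 m)
    thus ?case using that[of "u + of_int (m - 1) * d"] by (simp add: algebra_simps)
  qed simp
  from assms(3) obtain m l :: int where "z - w = of_int m * of_real pi + of_int l * of_real pi * \<tau>"
    unfolding equivalent_def period_lattice_def by blast
  hence "z = w + of_int m * of_real pi + of_int l * (of_real pi * \<tau>)"
    by (simp add: algebra_simps)
  thus ?thesis
    using *[OF tau, of "w + of_int m * of_real pi" l] *[OF pi, of w m] by simp
qed

lemma equivalent_refl: "equivalent \<tau> z z"
  unfolding equivalent_def period_lattice_def by (auto intro!: exI[of _ 0])

lemma equivalent_sym:
  assumes "equivalent \<tau> z w"
  shows "equivalent \<tau> w z"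
proof -
  from assms obtain m l :: int where "z - w = of_int m * of_real pi + of_int l * of_real pi * \<tau>"
    unfolding equivalent_def period_lattice_def by blast
  hence "w - z = of_int (- m) * of_real pi + of_int (- l) * of_real pi * \<tau>"
    by (simp add: algebra_simps)
  thus ?thesis
    unfolding equivalent_def period_lattice_def by blast
qed

lemma fundamental_parallelogram:
  assumes "Im \<tau> > 0"
  obtains s t where "s \<in> {0..1}" "t \<in> {0..1}"
    "equivalent \<tau> z (of_real s * of_real pi + of_real t * (of_real pi * \<tau>))"
proof -
  \<comment> \<open>Coordinates of \<open>z\<close> in the real basis pi, pi tau: the imaginary part
    determines \<open>b\<close>, then the real part determines \<open>a\<close>.\<close>
  define b where "b = Im z / (pi * Im \<tau>)"
  define a where "a = (Re z - b * pi * Re \<tau>) / pi"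
  have z: "z = of_real a * of_real pi + of_real b * (of_real pi * \<tau>)"
    using assms by (intro complex_eqI) (auto simp: a_def b_def field_simps)
  have "z - (of_real (frac a) * of_real pi + of_real (frac b) * (of_real pi * \<tau>)) =
        of_int \<lfloor>a\<rfloor> * of_real pi + of_int \<lfloor>b\<rfloor> * of_real pi * \<tau>"
    by (subst z) (simp add: frac_def algebra_simps)
  hence "equivalent \<tau> z (of_real (frac a) * of_real pi + of_real (frac b) * (of_real pi * \<tau>))"
    unfolding equivalent_def period_lattice_def by blast
  moreover have "frac a \<in> {0..1}" "frac b \<in> {0..1}"
    by (auto simp: frac_lt_1 less_imp_le)
  ultimately show ?thesis
    using that by blast
qed

text \<open>Every value is attained on a compact parallelogram, so \<open>f\<close> is bounded and
  Liouville applies.\<close>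

lemma elliptic_entire_constant:
  assumes "Im \<tau> > 0" and f: "f holomorphic_on UNIV"
    and pi: "\<And>z. f (z + of_real pi) = f z"
    and tau: "\<And>z. f (z + of_real pi * \<tau>) = f z"
  shows "f constant_on UNIV"
proof -
  define g where "g = (\<lambda>(s, t). f (of_real s * of_real pi + of_real t * (of_real pi * \<tau>)))"
  have "continuous_on ({0..1} \<times> {0..1}) g"
    unfolding g_def case_prod_unfold
    by (intro continuous_on_compose2[OF holomorphic_on_imp_continuous_on[OF f]] continuous_intros) auto
  hence "compact (g ` ({0..1} \<times> {0..1}))"
    by (intro compact_continuous_image compact_Times) auto
  hence "bounded (g ` ({0..1} \<times> {0..1}))"
    by (rule compact_imp_bounded)
  moreover have "range f \<subseteq> g ` ({0..1} \<times> {0..1})"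
  proof
    fix x assume "x \<in> range f"
    then obtain z where z: "x = f z" by blast
    obtain s t where st: "s \<in> {0..1}" "t \<in> {0..1}"
      "equivalent \<tau> z (of_real s * of_real pi + of_real t * (of_real pi * \<tau>))"
      using fundamental_parallelogram[OF assms(1)] by metis
    have "x = g (s, t)"
      using equivalent_induct[of "\<lambda>w. f w = x", OF _ _ st(3)] pi tau z by (simp add: g_def)
    with st show "x \<in> g ` ({0..1} \<times> {0..1})" by blast
  qed
  ultimately have "bounded (range f)"
    using bounded_subset by blast
  from Liouville_theorem[OF f this] show ?thesis .
qed

text \<open>The derivative is elliptic and entire, hence constant. So \<open>f\<close> is affine,
  and the period pi forces slope zero.\<close>

lemma quasi_periodic_entire:
  assumes "Im \<tau> > 0" and f: "f holomorphic_on UNIV"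
    and pi: "\<And>z. f (z + of_real pi) = f z"
    and tau: "\<And>z. f (z + of_real pi * \<tau>) = f z + c"
  shows "c = 0"
proof -
  have df: "(f has_field_derivative deriv f z) (at z)" for z
    using f by (intro holomorphic_derivI) auto
  have d: "deriv f (z + d) = deriv f z" if "\<And>z. f (z + d) = f z + e" for z d e
  proof -
    have "((\<lambda>w. f (w + d)) has_field_derivative deriv f (z + d)) (at z)"
      using df[of "z + d"] by (simp add: DERIV_shift)
    moreover have "((\<lambda>w. f (w + d)) has_field_derivative deriv f z) (at z)"
      unfolding that by (auto intro!: derivative_eq_intros df)
    ultimately show ?thesis
      by (rule DERIV_unique)
  qed
  have "deriv f constant_on UNIV"
  proof (rule elliptic_entire_constant[OF assms(1)])
    show "deriv f holomorphic_on UNIV"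
      using f by (intro holomorphic_intros) auto
    show "deriv f (z + of_real pi) = deriv f z" for z
      using d[of _ 0] pi by simp
    show "deriv f (z + of_real pi * \<tau>) = deriv f z" for z
      using d tau by blast
  qed
  then obtain k where k: "deriv f z = k" for z
    unfolding constant_on_def by blast
  have "\<exists>e. \<forall>z\<in>UNIV. f z - k * z = e"
    by (rule has_field_derivative_zero_constant)
       (use df in \<open>auto intro!: derivative_eq_intros simp: k\<close>)
  then obtain e where e: "f z = k * z + e" for z
    by (metis UNIV_I diff_add_cancel add.commute)
  from pi[of 0] e have "k = 0"
    by simp
  with tau[of 0] e show ?thesis
    by simp
qed

section \<open>Entire power series\<close>

text \<open>The ratio of consecutive terms is \<open>\<rho> n * w\<close>, which tends to 0 for
  every \<open>w\<close>.\<close>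

lemma summable_power_series_ratio:
  fixes c :: "nat \<Rightarrow> complex"
  assumes c: "\<And>n. c (Suc n) = \<rho> n * c n" and \<rho>: "\<rho> \<longlonglongrightarrow> 0"
  shows "summable (\<lambda>n. c n * w ^ n)"
proof -
  have "(\<lambda>n. \<rho> n * w) \<longlonglongrightarrow> 0"
    using tendsto_mult[OF \<rho> tendsto_const[of w]] by simp
  from order_tendstoD(2)[OF tendsto_norm_zero[OF this], of "1/2"]
  obtain N where N: "\<And>n. n \<ge> N \<Longrightarrow> norm (\<rho> n * w) < 1 / 2"
    by (auto simp: eventually_sequentially)
  show ?thesis
  proof (rule summable_ratio_test[of "1/2" N])
    fix n assume "n \<ge> N"
    have "norm (c (Suc n) * w ^ Suc n) = norm (\<rho> n * w) * norm (c n * w ^ n)"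
      by (simp add: c norm_mult norm_power mult_ac)
    also have "\<dots> \<le> 1 / 2 * norm (c n * w ^ n)"
      using N[OF \<open>n \<ge> N\<close>] by (intro mult_right_mono) auto
    finally show "norm (c (Suc n) * w ^ Suc n) \<le> 1 / 2 * norm (c n * w ^ n)" .
  qed simp
qed

lemma holomorphic_power_series_UNIV:
  fixes c :: "nat \<Rightarrow> complex"
  assumes "\<And>w. summable (\<lambda>n. c n * w ^ n)"
  shows "(\<lambda>w. \<Sum>n. c n * w ^ n) holomorphic_on UNIV"
  using termdiffs_strong_converges_everywhere[OF assms]
  by (auto simp: holomorphic_on_open)

section \<open>The Euler product\<close>

text \<open>The power series of the infinite product of \<open>1 - q\<^sup>n w\<close> over \<open>n \<ge> 0\<close>; its coefficients
  are forced by the functional equation \<open>E w = (1 - w) * E (q * w)\<close>.\<close>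

definition euler_coeff :: "complex \<Rightarrow> nat \<Rightarrow> complex" where
  "euler_coeff q n = (\<Prod>k<n. - (q ^ k) / (1 - q ^ Suc k))"

definition euler_product :: "complex \<Rightarrow> complex \<Rightarrow> complex" where
  "euler_product q w = (\<Sum>n. euler_coeff q n * w ^ n)"

context
  fixes q :: complex
  assumes q: "norm q < 1"
begin

lemma power_Suc_neq_1: "q ^ Suc k \<noteq> 1"
proof
  assume "q ^ Suc k = 1"
  hence "norm q ^ Suc k = 1"
    by (metis norm_one norm_power)
  thus False
    using q power_Suc_less_one[of "norm q" k] norm_ge_zero[of q]
    by (cases "norm q = 0") auto
qed

lemma summable_euler: "summable (\<lambda>n. euler_coeff q n * w ^ n)"
proof (rule summable_power_series_ratio)
  show "euler_coeff q (Suc n) = - (q ^ n) / (1 - q ^ Suc n) * euler_coeff q n" for n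
    by (simp add: euler_coeff_def)
  have "(\<lambda>n. - (q ^ n) / (1 - q * q ^ n)) \<longlonglongrightarrow> - 0 / (1 - q * 0)"
    by (intro tendsto_intros q) auto
  thus "(\<lambda>n. - (q ^ n) / (1 - q ^ Suc n)) \<longlonglongrightarrow> 0"
    by simp
qed

lemma holomorphic_euler_product: "euler_product q holomorphic_on UNIV"
  using holomorphic_power_series_UNIV[OF summable_euler] by (simp add: euler_product_def [abs_def])

lemma euler_product_functional: "euler_product q w = (1 - w) * euler_product q (q * w)"
proof -
  define e where "e = euler_coeff q"
  have e: "e (Suc n) * (1 - q ^ Suc n) = - (q ^ n) * e n" for n
    using power_Suc_neq_1[of n] by (simp add: e_def euler_coeff_def)
  note sm = summable_euler[folded e_def, THEN summable_sums]
  have E: "(\<lambda>n. e n * w ^ n) sums euler_product q w" "(\<lambda>n. e n * (q * w) ^ n) sums euler_product q (q * w)"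
    using sm by (auto simp: euler_product_def e_def)
  have "(\<lambda>n. e n * w ^ n - e n * (q * w) ^ n) sums (euler_product q w - euler_product q (q * w))"
    by (intro sums_diff E)
  moreover have "(\<lambda>n. - w * (e n * (q * w) ^ n)) sums (- w * euler_product q (q * w))"
    by (intro sums_mult E)
  hence "(\<lambda>n. e (Suc n) * w ^ Suc n - e (Suc n) * (q * w) ^ Suc n) sums (- w * euler_product q (q * w))"
  proof (rule sums_cong[THEN iffD1, rotated])
    fix n
    have "e (Suc n) * w ^ Suc n - e (Suc n) * (q * w) ^ Suc n = (e (Suc n) * (1 - q ^ Suc n)) * w ^ Suc n"
      by (simp add: power_mult_distrib algebra_simps)
    also have "\<dots> = - w * (e n * (q * w) ^ n)"
      unfolding e by (simp add: power_mult_distrib algebra_simps)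
    finally show "- w * (e n * (q * w) ^ n) = e (Suc n) * w ^ Suc n - e (Suc n) * (q * w) ^ Suc n" ..
  qed
  \<comment> \<open>The constant terms of the two series cancel, so restoring index 0 adds
    nothing.\<close>
  from sums_Suc[OF this] have "(\<lambda>n. e n * w ^ n - e n * (q * w) ^ n) sums (- w * euler_product q (q * w))"
    by simp
  ultimately have "euler_product q w - euler_product q (q * w) = - w * euler_product q (q * w)"
    by (rule sums_unique2)
  thus ?thesis
    by (simp add: algebra_simps)
qed

lemma euler_product_0: "euler_product q 0 = 1"
  by (simp add: euler_product_def euler_coeff_def)

text \<open>As long as no factor \<open>1 - w * q ^ n\<close> vanishes, the functional equation
  passes a zero on from \<open>q ^ n * w\<close> to the next power. These points tend to 0, where
  the value is 1.\<close>

lemma euler_product_zeroD: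
  assumes "euler_product q w = 0"
  shows "\<exists>n. w * q ^ n = 1"
proof (rule ccontr)
  assume *: "\<not> ?thesis"
  have zero: "euler_product q (q ^ n * w) = 0" for n
  proof (induction n)
    case (Suc n)
    thus ?case
      using euler_product_functional[of "q ^ n * w"] * by (auto simp: mult_ac)
  qed (use assms in auto)
  have "isCont (euler_product q) 0"
    using holomorphic_on_imp_continuous_on[OF holomorphic_euler_product]
    by (simp add: continuous_on_eq_continuous_at)
  moreover have "(\<lambda>n. q ^ n * w) \<longlonglongrightarrow> 0"
    using tendsto_mult[OF LIMSEQ_power_zero[OF q] tendsto_const[of w]] by simp
  ultimately have "(\<lambda>n. euler_product q (q ^ n * w)) \<longlonglongrightarrow> euler_product q 0"
    by (rule isCont_tendsto_compose)
  thus False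
    by (simp add: zero euler_product_0 LIMSEQ_const_iff)
qed

end

section \<open>The theta functions\<close>

lemma nome_pow_add: "nome_pow \<tau> (a + b) = nome_pow \<tau> a * nome_pow \<tau> b"
  by (simp add: nome_pow_def exp_add [symmetric] algebra_simps)

lemma nome_pow_nonzero [simp]: "nome_pow \<tau> s \<noteq> 0"
  by (simp add: nome_pow_def)

lemma nome_pow_0 [simp]: "nome_pow \<tau> 0 = 1"
  by (simp add: nome_pow_def)

lemma nome_pow_of_nat: "nome_pow \<tau> (of_nat n) = nome_pow \<tau> 1 ^ n"
  by (simp add: nome_pow_def exp_of_nat_mult [symmetric] mult_ac)

lemma nome_pow_half_square: "nome_pow \<tau> (1/2) * nome_pow \<tau> (1/2) = nome_pow \<tau> 1"
  by (simp add: nome_pow_add [symmetric])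

lemma norm_nome: "Im \<tau> > 0 \<Longrightarrow> norm (nome_pow \<tau> 1) < 1"
  by (simp add: nome_pow_def)

lemma exp_2i_pi: "exp (2 * \<i> * (z + of_real pi)) = exp (2 * \<i> * z)"
  by (simp add: exp_add ring_distribs exp_two_pi_i' mult_ac)

lemma exp_2i_pi_tau: "exp (2 * \<i> * (z + of_real pi * \<tau>)) = nome_pow \<tau> 1 * exp (2 * \<i> * z)"
  by (simp add: nome_pow_def exp_add [symmetric] algebra_simps)

text \<open>The nonnegative half of the two-sided theta_3 series in
  \<open>w = exp (2 * \<i> * z)\<close>. The half is a power series, hence entire in
  \<open>w\<close>; the full series is only a Laurent series.\<close>

definition half_theta :: "complex \<Rightarrow> complex \<Rightarrow> complex" where
  "half_theta \<tau> w = (\<Sum>n. nome_pow \<tau> ((real n)\<^sup>2 / 2) * w ^ n)"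

context
  fixes \<tau> :: complex
  assumes \<tau>: "Im \<tau> > 0"
begin

lemma summable_half_theta: "summable (\<lambda>n. nome_pow \<tau> ((real n)\<^sup>2 / 2) * w ^ n)"
proof (rule summable_power_series_ratio)
  \<comment> \<open>Consecutive exponents differ by ((n+1)^2 - n^2)/2 = n + 1/2.\<close>
  show "nome_pow \<tau> ((real (Suc n))\<^sup>2 / 2) =
          (nome_pow \<tau> 1 ^ n * nome_pow \<tau> (1/2)) * nome_pow \<tau> ((real n)\<^sup>2 / 2)" for n
    by (simp add: nome_pow_of_nat [symmetric] nome_pow_add [symmetric] power2_eq_square field_simps)
  show "(\<lambda>n. nome_pow \<tau> 1 ^ n * nome_pow \<tau> (1/2)) \<longlonglongrightarrow> 0"
    using tendsto_mult[OF LIMSEQ_power_zero[OF norm_nome[OF \<tau>]] tendsto_const] by simp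
qed

lemma holomorphic_half_theta: "half_theta \<tau> holomorphic_on UNIV"
  using holomorphic_power_series_UNIV[OF summable_half_theta] by (simp add: half_theta_def [abs_def])

lemma half_theta_0: "half_theta \<tau> 0 = 1"
  by (simp add: half_theta_def)

text \<open>Once the constant term is split off, (n+1)^2/2 = 1/2 + n^2/2 + n turns the tail into the
  same series at \<open>q * w\<close>.\<close>

lemma half_theta_functional:
  "half_theta \<tau> w = 1 + nome_pow \<tau> (1/2) * w * half_theta \<tau> (nome_pow \<tau> 1 * w)"
proof -
  have "(\<lambda>n. nome_pow \<tau> (1/2) * w * (nome_pow \<tau> ((real n)\<^sup>2 / 2) * (nome_pow \<tau> 1 * w) ^ n))
          sums (nome_pow \<tau> (1/2) * w * half_theta \<tau> (nome_pow \<tau> 1 * w))"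
    unfolding half_theta_def by (intro sums_mult summable_sums summable_half_theta)
  moreover have "nome_pow \<tau> (1/2) * w * (nome_pow \<tau> ((real n)\<^sup>2 / 2) * (nome_pow \<tau> 1 * w) ^ n) =
                 nome_pow \<tau> ((real (Suc n))\<^sup>2 / 2) * w ^ Suc n" for n
  proof -
    have "(real (Suc n))\<^sup>2 / 2 = 1/2 + (real n)\<^sup>2 / 2 + real n"
      by (simp add: power2_eq_square field_simps)
    hence "nome_pow \<tau> ((real (Suc n))\<^sup>2 / 2) =
        nome_pow \<tau> (1/2) * nome_pow \<tau> ((real n)\<^sup>2 / 2) * nome_pow \<tau> 1 ^ n"
      by (simp only: nome_pow_add nome_pow_of_nat)
    thus ?thesis
      by (simp add: power_mult_distrib mult_ac)
  qed
  ultimately have "(\<lambda>n. nome_pow \<tau> ((real (Suc n))\<^sup>2 / 2) * w ^ Suc n)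
      sums (nome_pow \<tau> (1/2) * w * half_theta \<tau> (nome_pow \<tau> 1 * w))"
    by simp
  from sums_Suc[OF this] have "(\<lambda>n. nome_pow \<tau> ((real n)\<^sup>2 / 2) * w ^ n)
      sums (nome_pow \<tau> (1/2) * w * half_theta \<tau> (nome_pow \<tau> 1 * w) + 1)"
    by simp
  thus ?thesis
    unfolding half_theta_def[of \<tau> w] by (simp add: sums_iff)
qed

text \<open>Each cosine is half the sum of two exponentials. Both halves contain the constant term,
  hence the \<open>- 1\<close>.\<close>

lemma theta3_half_theta:
  "theta3 z \<tau> = half_theta \<tau> (exp (2 * \<i> * z)) + half_theta \<tau> (exp (- 2 * \<i> * z)) - 1"
proof -
  define c where "c = (\<lambda>n. nome_pow \<tau> ((real n)\<^sup>2 / 2))"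
  have S: "(\<lambda>n. c (Suc n) * w ^ Suc n) sums (half_theta \<tau> w - 1)" for w
  proof -
    have "(\<lambda>n. c n * w ^ n) sums (half_theta \<tau> w - 1 + c 0 * w ^ 0)"
      using summable_sums[OF summable_half_theta[of w]] by (simp add: c_def half_theta_def)
    thus ?thesis
      by (subst sums_Suc_iff)
  qed
  have "(\<lambda>n. (c (Suc n) * exp (2 * \<i> * z) ^ Suc n + c (Suc n) * exp (- 2 * \<i> * z) ^ Suc n) / 2)
      sums ((half_theta \<tau> (exp (2 * \<i> * z)) - 1 + (half_theta \<tau> (exp (- 2 * \<i> * z)) - 1)) / 2)"
    by (intro sums_divide sums_add S)
  moreover have "(c (Suc n) * exp (2 * \<i> * z) ^ Suc n + c (Suc n) * exp (- 2 * \<i> * z) ^ Suc n) / 2 =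
      c (Suc n) * cos (2 * of_nat (Suc n) * z)" for n
    unfolding exp_of_nat_mult [symmetric] cos_exp_eq by (simp add: algebra_simps)
  ultimately have "(\<Sum>n. c (Suc n) * cos (2 * of_nat (Suc n) * z)) =
      (half_theta \<tau> (exp (2 * \<i> * z)) - 1 + (half_theta \<tau> (exp (- 2 * \<i> * z)) - 1)) / 2"
    by (simp only: sums_iff)
  thus ?thesis
    by (simp add: theta3_def c_def field_simps)
qed

lemma holomorphic_theta3: "(\<lambda>z. theta3 z \<tau>) holomorphic_on UNIV"
  unfolding theta3_half_theta
  by (intro holomorphic_intros holomorphic_on_compose_gen[OF _ holomorphic_half_theta, unfolded o_def]) auto

lemma theta3_pi: "theta3 (z + of_real pi) \<tau> = theta3 z \<tau>"
  using exp_2i_pi[of z] by (simp add: theta3_half_theta exp_minus)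

text \<open>The shift multiplies \<open>w\<close> by \<open>q\<close>, and the functional equation
  of the half series moves one term from one half to the other.\<close>

lemma theta3_pi_tau:
  "nome_pow \<tau> (1/2) * exp (2 * \<i> * z) * theta3 (z + of_real pi * \<tau>) \<tau> = theta3 z \<tau>"
proof -
  define w where "w = exp (2 * \<i> * z)"
  define p where "p = nome_pow \<tau> (1/2)"
  define q where "q = nome_pow \<tau> 1"
  have [simp]: "w \<noteq> 0" "p \<noteq> 0" "q \<noteq> 0" by (auto simp: w_def p_def q_def)
  have pq: "p * p = q" by (simp add: p_def q_def nome_pow_half_square)
  have "theta3 (z + of_real pi * \<tau>) \<tau> = half_theta \<tau> (q * w) + half_theta \<tau> (inverse (q * w)) - 1"
    using exp_2i_pi_tau[of z] by (simp add: theta3_half_theta exp_minus w_def q_def)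
  also have "half_theta \<tau> (inverse (q * w)) = 1 + p * inverse (q * w) * half_theta \<tau> (inverse w)"
    by (subst half_theta_functional) (simp add: p_def [symmetric] q_def [symmetric] mult.assoc [symmetric])
  finally have "p * w * theta3 (z + of_real pi * \<tau>) \<tau> =
      p * w * half_theta \<tau> (q * w) + half_theta \<tau> (inverse w)"
    by (simp add: pq [symmetric] field_simps)
  also have "p * w * half_theta \<tau> (q * w) = half_theta \<tau> w - 1"
    by (subst half_theta_functional[of w]) (simp add: p_def q_def)
  finally show ?thesis
    by (simp add: theta3_half_theta exp_minus w_def p_def)
qed

text \<open>Since (2n+1)^2/8 = 1/8 + n^2/2 + n/2, the sine series is a theta_3 series at a half
  period shift, which replaces \<open>w\<close> by \<open>- p * w\<close>. Theta_1 inherits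
  holomorphy and both multipliers this way.\<close>

lemma theta1_theta3:
  "theta1 z \<tau> = - \<i> * nome_pow \<tau> (1/8) * exp (\<i> * z) * theta3 (z + of_real pi / 2 + of_real pi * \<tau> / 2) \<tau>"
proof -
  define w where "w = exp (2 * \<i> * z)"
  define p where "p = nome_pow \<tau> (1/2)"
  define q where "q = nome_pow \<tau> 1"
  have [simp]: "w \<noteq> 0" "p \<noteq> 0" "q \<noteq> 0" by (auto simp: w_def p_def q_def)
  have pq: "p * p = q" by (simp add: p_def q_def nome_pow_half_square)
  have term_eq: "2 * ((- 1) ^ n * nome_pow \<tau> ((2 * real n + 1)\<^sup>2 / 8) * sin ((2 * of_nat n + 1) * z)) =
      - \<i> * nome_pow \<tau> (1/8) * (exp (\<i> * z) * (nome_pow \<tau> ((real n)\<^sup>2 / 2) * (- p * w) ^ n)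
         - exp (- (\<i> * z)) * (nome_pow \<tau> ((real n)\<^sup>2 / 2) * (- p * inverse w) ^ n))" for n
  proof -
    have "(2 * real n + 1)\<^sup>2 / 8 = 1/8 + (real n)\<^sup>2 / 2 + real n * (1/2)"
      by (simp add: power2_eq_square field_simps)
    hence 1: "nome_pow \<tau> ((2 * real n + 1)\<^sup>2 / 8) = nome_pow \<tau> (1/8) * nome_pow \<tau> ((real n)\<^sup>2 / 2) * p ^ n"
      unfolding p_def by (simp only: nome_pow_add)
        (simp add: nome_pow_def exp_of_nat_mult [symmetric] mult_ac)
    have 2: "exp (\<i> * ((2 * of_nat n + 1) * z)) = exp (\<i> * z) * w ^ n"
      by (simp add: w_def exp_of_nat_mult [symmetric] exp_add [symmetric] algebra_simps)
    have 3: "exp (- (\<i> * ((2 * of_nat n + 1) * z))) = exp (- (\<i> * z)) * inverse w ^ n"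
      unfolding exp_minus 2 by (simp add: power_inverse)
    have 4: "(- p * u) ^ n = (- 1) ^ n * p ^ n * u ^ n" for u
      by (simp add: power_mult_distrib power_minus')
    show ?thesis
      unfolding 1 4 sin_exp_eq' 2 3 by (simp add: field_simps)
  qed
  have "(\<lambda>n. 2 * ((- 1) ^ n * nome_pow \<tau> ((2 * real n + 1)\<^sup>2 / 8) * sin ((2 * of_nat n + 1) * z))) sums
      (- \<i> * nome_pow \<tau> (1/8) * (exp (\<i> * z) * half_theta \<tau> (- p * w)
         - exp (- (\<i> * z)) * half_theta \<tau> (- p * inverse w)))"
    unfolding term_eq half_theta_def
    by (intro sums_mult sums_diff summable_sums summable_half_theta)
  hence "(\<lambda>n. (2 * ((- 1) ^ n * nome_pow \<tau> ((2 * real n + 1)\<^sup>2 / 8) * sin ((2 * of_nat n + 1) * z))) / 2) sums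
      ((- \<i> * nome_pow \<tau> (1/8) * (exp (\<i> * z) * half_theta \<tau> (- p * w)
         - exp (- (\<i> * z)) * half_theta \<tau> (- p * inverse w))) / 2)"
    by (rule sums_divide)
  hence t1: "theta1 z \<tau> = - \<i> * nome_pow \<tau> (1/8) * (exp (\<i> * z) * half_theta \<tau> (- p * w)
         - exp (- (\<i> * z)) * half_theta \<tau> (- p * inverse w))"
    by (simp add: theta1_def sums_iff)
  have "exp (2 * \<i> * (z + of_real pi / 2 + of_real pi * \<tau> / 2)) =
        exp (2 * \<i> * z) * exp (of_real pi * \<i>) * exp (of_real pi * \<i> * \<tau>)"
    unfolding exp_add [symmetric] by (rule arg_cong[of _ _ exp]) (simp add: algebra_simps)
  hence w': "exp (2 * \<i> * (z + of_real pi / 2 + of_real pi * \<tau> / 2)) = - p * w"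
    by (simp add: w_def p_def nome_pow_def mult_ac)
  \<comment> \<open>At \<open>u = inverse (- p * w)\<close> the functional equation has
    \<open>p * u = - inverse w\<close> and \<open>q * u = - p * inverse w\<close>.\<close>
  have half_inv: "half_theta \<tau> (inverse (- p * w)) = 1 - inverse w * half_theta \<tau> (- p * inverse w)"
    by (subst half_theta_functional)
       (simp add: p_def [symmetric] q_def [symmetric] pq [symmetric] field_simps)
  have theta3_eq: "theta3 (z + of_real pi / 2 + of_real pi * \<tau> / 2) \<tau> =
      half_theta \<tau> (- p * w) + half_theta \<tau> (inverse (- p * w)) - 1"
    by (simp only: theta3_half_theta mult_minus_left exp_minus w')
  have exp_eq: "exp (- (\<i> * z)) = exp (\<i> * z) * inverse w"
    by (simp add: w_def exp_minus [symmetric] exp_add [symmetric])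
  have "exp (\<i> * z) * theta3 (z + of_real pi / 2 + of_real pi * \<tau> / 2) \<tau> =
      exp (\<i> * z) * half_theta \<tau> (- p * w) - exp (- (\<i> * z)) * half_theta \<tau> (- p * inverse w)"
    unfolding theta3_eq half_inv exp_eq by (simp add: algebra_simps)
  thus ?thesis
    by (simp add: t1 mult.assoc)
qed

lemma holomorphic_theta1: "(\<lambda>z. theta1 z \<tau>) holomorphic_on UNIV"
  unfolding theta1_theta3
  by (intro holomorphic_intros holomorphic_on_compose_gen[OF _ holomorphic_theta3, unfolded o_def]) auto

lemma theta1_pi: "theta1 (z + of_real pi) \<tau> = - theta1 z \<tau>"
proof -
  have "z + of_real pi + of_real pi / 2 + of_real pi * \<tau> / 2 =
        (z + of_real pi / 2 + of_real pi * \<tau> / 2) + of_real pi"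
    by simp
  hence "theta3 (z + of_real pi + of_real pi / 2 + of_real pi * \<tau> / 2) \<tau> =
      theta3 (z + of_real pi / 2 + of_real pi * \<tau> / 2) \<tau>"
    by (metis theta3_pi)
  moreover have "exp (\<i> * (z + of_real pi)) = - exp (\<i> * z)"
    by (simp add: exp_add ring_distribs mult.commute[of \<i>])
  ultimately show ?thesis
    by (simp add: theta1_theta3)
qed

lemma theta1_pi_tau:
  "nome_pow \<tau> (1/2) * exp (2 * \<i> * z) * theta1 (z + of_real pi * \<tau>) \<tau> = - theta1 z \<tau>"
proof -
  define u where "u = z + of_real pi / 2 + of_real pi * \<tau> / 2"
  have u: "z + of_real pi * \<tau> + of_real pi / 2 + of_real pi * \<tau> / 2 = u + of_real pi * \<tau>"
    by (simp add: u_def)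
  have "exp (2 * \<i> * u) = exp (2 * \<i> * z) * exp (of_real pi * \<i>) * exp (of_real pi * \<i> * \<tau>)"
    unfolding exp_add [symmetric] by (rule arg_cong[of _ _ exp]) (simp add: u_def algebra_simps)
  hence eu: "exp (2 * \<i> * u) = - exp (2 * \<i> * z) * exp (of_real pi * \<i> * \<tau>)"
    by (simp only: exp_pi_i mult_minus_right mult_minus_left mult_1_right)
  have ez: "exp (\<i> * (z + of_real pi * \<tau>)) = exp (\<i> * z) * exp (of_real pi * \<i> * \<tau>)"
    by (simp add: exp_add [symmetric] algebra_simps)
  have "nome_pow \<tau> (1/2) * exp (2 * \<i> * z) * theta1 (z + of_real pi * \<tau>) \<tau> =
        - (- \<i> * nome_pow \<tau> (1/8) * exp (\<i> * z) *
           (nome_pow \<tau> (1/2) * exp (2 * \<i> * u) * theta3 (u + of_real pi * \<tau>) \<tau>))"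
    unfolding theta1_theta3[of "z + _"] u eu ez by (simp add: algebra_simps)
  also have "\<dots> = - theta1 z \<tau>"
    unfolding theta3_pi_tau by (simp add: theta1_theta3 u_def)
  finally show ?thesis .
qed

lemma theta1_0: "theta1 0 \<tau> = 0"
  by (simp add: theta1_def)

lemma theta1_lattice:
  assumes "equivalent \<tau> z w"
  shows "theta1 z \<tau> = 0 \<longleftrightarrow> theta1 w \<tau> = 0"
proof (rule equivalent_induct[OF _ _ assms])
  fix z
  show "theta1 z \<tau> = 0 \<longleftrightarrow> theta1 (z + of_real pi) \<tau> = 0"
    by (simp add: theta1_pi)
  show "theta1 z \<tau> = 0 \<longleftrightarrow> theta1 (z + of_real pi * \<tau>) \<tau> = 0"
    using theta1_pi_tau[of z] by auto
qed

end

section \<open>The zeros of the first theta function\<close>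

context
  fixes \<tau> :: complex
  assumes \<tau>: "Im \<tau> > 0"
begin

text \<open>If \<open>\<theta>\<^sub>1\<close> vanished identically, then \<open>h w + h (1 / w) = 1\<close> for \<open>h = half_theta \<tau>\<close>; such an
  entire \<open>h\<close> is bounded, hence constant, against its functional equation.\<close>

lemma theta1_not_identically_zero: "\<exists>z. theta1 z \<tau> \<noteq> 0"
proof (rule ccontr)
  assume "\<not> ?thesis"
  hence zero: "theta3 u \<tau> = 0" for u
    using theta1_theta3[OF \<tau>, of "u - of_real pi / 2 - of_real pi * \<tau> / 2"] by simp
  have refl: "half_theta \<tau> w = 1 - half_theta \<tau> (inverse w)" if "w \<noteq> 0" for w
  proof -
    have w: "exp (2 * \<i> * (Ln w / (2 * \<i>))) = w"
      using that by simp
    have "exp (- 2 * \<i> * (Ln w / (2 * \<i>))) = inverse w"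
      using that by (simp add: exp_minus)
    with w zero[of "Ln w / (2 * \<i>)"] show ?thesis
      unfolding theta3_half_theta[OF \<tau>] by (simp add: algebra_simps add_eq_0_iff)
  qed
  have "continuous_on (cball 0 1) (half_theta \<tau>)"
    using holomorphic_half_theta[OF \<tau>] holomorphic_on_imp_continuous_on continuous_on_subset by blast
  hence "bounded (half_theta \<tau> ` cball 0 1)"
    by (intro compact_imp_bounded compact_continuous_image) auto
  then obtain B where "\<forall>w\<in>cball 0 1. norm (half_theta \<tau> w) \<le> B"
    by (auto simp: bounded_iff)
  hence B: "norm (half_theta \<tau> w) \<le> B" if "norm w \<le> 1" for w
    using that by simp
  have "norm (half_theta \<tau> w) \<le> 1 + B" for w
  proof (cases "norm w \<le> 1")
    case False
    hence "w \<noteq> 0" "norm (inverse w) \<le> 1"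
      by (auto simp: norm_inverse inverse_le_1_iff)
    thus ?thesis
      using refl[of w] B[of "inverse w"] norm_triangle_ineq4[of 1 "half_theta \<tau> (inverse w)"] by simp
  qed (use B[of w] in simp)
  hence "bounded (range (half_theta \<tau>))"
    by (auto simp: bounded_iff)
  with holomorphic_half_theta[OF \<tau>] have "half_theta \<tau> constant_on UNIV"
    by (intro Liouville_theorem)
  hence "half_theta \<tau> w = 1" for w
    using half_theta_0[OF \<tau>] by (metis UNIV_I constant_on_def)
  with half_theta_functional[OF \<tau>, of 1] show False
    by simp
qed

lemma eventually_theta1_nonzero: "\<forall>\<^sub>F w in at p. theta1 w \<tau> \<noteq> 0"
proof -
  obtain z where "theta1 z \<tau> \<noteq> 0"
    using theta1_not_identically_zero by blast
  from non_zero_neighbour_alt[OF holomorphic_theta1[OF \<tau>] _ _ _ _ this, of p] show ?thesis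
    by (auto elim: eventually_mono)
qed

text \<open>The quotient \<open>R\<close> of \<open>N\<close> and \<open>P\<close> is elliptic, and
  its singularities at lattice points are removable. So \<open>N\<close> is a nonzero multiple of
  \<open>P\<close>, and both claims are read off from \<open>P\<close>.\<close>

lemma theta1_zeros:
  shows theta1_eq_0_iff: "theta1 z \<tau> = 0 \<longleftrightarrow> equivalent \<tau> z 0"
    and deriv_theta1_0: "deriv (\<lambda>w. theta1 w \<tau>) 0 \<noteq> 0"
proof -
  define q where "q = nome_pow \<tau> 1"
  define E where "E = euler_product q"
  \<comment> \<open>With x = exp(2iz), the first factor can vanish only at x = q^(-n) and the second
    only at x = q^(n+1), n >= 0. Together these are the integer powers of q, that is, the lattice
    points.\<close>
  define P where "P = (\<lambda>z. E (exp (2 * \<i> * z)) * E (q * exp (- 2 * \<i> * z)))"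
  \<comment> \<open>The factor \<open>exp (\<i> * z)\<close> removes the sign of theta_1 under pi
    and matches the pi tau multiplier of \<open>P\<close>.\<close>
  define N where "N = (\<lambda>z. exp (\<i> * z) * theta1 z \<tau>)"
  have q: "norm q < 1" "q \<noteq> 0"
    using norm_nome[OF \<tau>] by (auto simp: q_def)
  note holE = holomorphic_euler_product[OF q(1), folded E_def]
  note feqE = euler_product_functional[OF q(1), folded E_def]
  have zeroE: "\<exists>n. w * q ^ n = 1" if "E w = 0" for w
    using euler_product_zeroD[OF q(1)] that by (simp add: E_def)
  have holP: "P holomorphic_on UNIV"
    unfolding P_def by (intro holomorphic_intros holomorphic_on_compose_gen[OF _ holE, unfolded o_def]) auto
  have holN: "N holomorphic_on UNIV"
    unfolding N_def by (intro holomorphic_intros holomorphic_theta1[OF \<tau>])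

  have equiv: "equivalent \<tau> z 0" if "exp (2 * \<i> * z) = q powi m" for z m
  proof -
    have "q powi m = exp (2 * \<i> * (of_int m * of_real pi * \<tau>))"
      by (simp add: q_def nome_pow_def exp_power_int mult_ac)
    with that obtain n :: int where
      "2 * \<i> * z = 2 * \<i> * (of_int m * of_real pi * \<tau>) + (of_int (2 * n) * pi) * \<i>"
      by (auto simp: exp_eq)
    also have "\<dots> = 2 * \<i> * (of_int n * of_real pi + of_int m * of_real pi * \<tau>)"
      by (simp add: algebra_simps)
    finally have "z = of_int n * of_real pi + of_int m * of_real pi * \<tau>"
      by simp
    thus ?thesis
      unfolding equivalent_def period_lattice_def by auto
  qed
  have zeroP: "equivalent \<tau> z 0" if "P z = 0" for z
  proof -
    from that consider "E (exp (2 * \<i> * z)) = 0" | "E (q * exp (- 2 * \<i> * z)) = 0"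
      by (auto simp: P_def)
    thus ?thesis
    proof cases
      case 1
      then obtain n where "exp (2 * \<i> * z) * q ^ n = 1"
        using zeroE by blast
      hence "exp (2 * \<i> * z) = q powi (- int n)"
        using q by (simp add: power_int_minus field_simps)
      thus ?thesis by (rule equiv)
    next
      case 2
      then obtain n where "q * exp (- 2 * \<i> * z) * q ^ n = 1"
        using zeroE by blast
      hence "exp (2 * \<i> * z) = q ^ Suc n"
        using q by (simp add: exp_minus field_simps)
      hence "exp (2 * \<i> * z) = q powi (int (Suc n))"
        by (simp only: power_int_of_nat)
      thus ?thesis by (rule equiv)
    qed
  qed
  have P_pi: "P (z + of_real pi) = P z" and N_pi: "N (z + of_real pi) = N z" for z
  proof -
    show "P (z + of_real pi) = P z"
      using exp_2i_pi[of z] by (simp add: P_def exp_minus)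
    have "exp (\<i> * (z + of_real pi)) = - exp (\<i> * z)"
      by (simp add: exp_add ring_distribs mult.commute[of \<i>])
    thus "N (z + of_real pi) = N z"
      by (simp add: N_def theta1_pi[OF \<tau>])
  qed
  have P_tau: "exp (2 * \<i> * z) * P (z + of_real pi * \<tau>) = - P z" for z
  proof -
    define w where "w = exp (2 * \<i> * z)"
    have "w \<noteq> 0" by (simp add: w_def)
    have "w * P (z + of_real pi * \<tau>) = w * (E (q * w) * E (inverse w))"
      using exp_2i_pi_tau[of z \<tau>] q by (simp add: P_def exp_minus w_def q_def mult.assoc [symmetric])
    \<comment> \<open>Expanding \<open>E (inverse w)\<close> yields the factor
      \<open>1 - inverse w\<close>, and \<open>w * (1 - inverse w) = - (1 - w)\<close>.\<close>
    also have "\<dots> = - ((1 - w) * E (q * w) * E (q * inverse w))"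
      using \<open>w \<noteq> 0\<close> by (subst feqE[of "inverse w"]) (simp add: field_simps)
    also have "\<dots> = - P z"
      unfolding feqE[of w, symmetric] by (simp add: P_def w_def exp_minus)
    finally show ?thesis
      by (simp add: w_def)
  qed
  have N_tau: "exp (2 * \<i> * z) * N (z + of_real pi * \<tau>) = - N z" for z
  proof -
    have "exp (\<i> * (z + of_real pi * \<tau>)) = exp (\<i> * z) * nome_pow \<tau> (1/2)"
      by (simp add: nome_pow_def exp_add [symmetric] algebra_simps)
    thus ?thesis
      using theta1_pi_tau[OF \<tau>, of z] by (simp add: N_def mult_ac)
  qed
  have derP: "P 0 = 0" "deriv P 0 \<noteq> 0"
  proof -
    \<comment> \<open>\<open>K\<close> is \<open>P\<close> without the only factor of it that
      vanishes at 0. A zero of \<open>K\<close> there would give a positive power of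
      \<open>q\<close> equal to 1.\<close>
    define K where "K = (\<lambda>z. E (q * exp (2 * \<i> * z)) * E (q * exp (- 2 * \<i> * z)))"
    have "K holomorphic_on UNIV"
      unfolding K_def by (intro holomorphic_intros holomorphic_on_compose_gen[OF _ holE, unfolded o_def]) auto
    hence K: "(K has_field_derivative deriv K 0) (at 0)"
      by (intro holomorphic_derivI) auto
    have P: "P = (\<lambda>z. (1 - exp (2 * \<i> * z)) * K z)"
      by (simp add: P_def K_def feqE[of "exp _"] mult.assoc)
    thus "P 0 = 0" by simp
    have "(P has_field_derivative - 2 * \<i> * K 0) (at 0)"
      unfolding P by (auto intro!: derivative_eq_intros K)
    moreover have "K 0 \<noteq> 0"
      using zeroE[of q] power_Suc_neq_1[OF q(1)] by (auto simp: K_def)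
    ultimately show "deriv P 0 \<noteq> 0"
      by (simp add: DERIV_imp_deriv)
  qed

  define R where "R = (\<lambda>z. N z / P z)"
  have R_pi: "R (z + of_real pi) = R z" for z
    by (simp add: R_def N_pi P_pi)
  have R_tau: "R (z + of_real pi * \<tau>) = R z" for z
  proof -
    have "R z = (- N z) / (- P z)"
      by (simp add: R_def)
    also have "\<dots> = R (z + of_real pi * \<tau>)"
      unfolding N_tau [symmetric] P_tau [symmetric] by (simp add: R_def)
    finally show ?thesis ..
  qed
  have an: "f analytic_on {p}" if "f holomorphic_on UNIV" for f :: "complex \<Rightarrow> complex" and p
    using that by (auto simp: analytic_at)
  have R0: "has_polar_part R 0 0"
    using has_polar_part_divide[OF an[OF holN] an[OF holP] derP]
    by (simp add: R_def N_def theta1_0[OF \<tau>])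
  have "has_polar_part R 0 p" for p
  proof (cases "P p = 0")
    case True
    have "has_polar_part R 0 p \<longleftrightarrow> has_polar_part R 0 0"
      by (rule equivalent_induct[OF _ _ zeroP[OF True]]) (simp_all add: has_polar_part_shift R_pi R_tau)
    with R0 show ?thesis by simp
  next
    case False
    thus ?thesis
      unfolding R_def by (intro has_polar_part_analytic analytic_intros an holN holP) auto
  qed
  then obtain H where H: "H holomorphic_on UNIV" "\<And>p. R \<midarrow>p\<rightarrow> H p"
    using entire_extension by blast
  have H_shift: "H (z + d) = H z" if "\<And>z. R (z + d) = R z" for z d
  proof (rule tendsto_unique)
    show "R \<midarrow>z\<rightarrow> H z" by (rule H)
    have "(\<lambda>w. R (w + d)) \<midarrow>z\<rightarrow> H (z + d)"
      using LIM_offset[OF H(2)[of "z + d"], of d] by simp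
    thus "R \<midarrow>z\<rightarrow> H (z + d)"
      by (simp add: that)
  qed simp
  have "H constant_on UNIV"
    by (rule elliptic_entire_constant[OF \<tau> H(1)]) (auto intro: H_shift R_pi R_tau)
  then obtain C where C: "H z = C" for z
    by (auto simp: constant_on_def)
  have N_eq: "N z = C * P z" for z
  \<comment> \<open>At a zero of \<open>P\<close> the quotient says nothing, but that point is in
    the lattice, so \<open>N\<close> vanishes too.\<close>
  proof (cases "P z = 0")
    case True
    thus ?thesis
      using theta1_lattice[OF \<tau> zeroP[OF True]] theta1_0[OF \<tau>] by (simp add: N_def)
  next
    case False
    have "R analytic_on {z}"
      unfolding R_def by (intro analytic_intros an holN holP) (use False in auto)
    hence "R \<midarrow>z\<rightarrow> R z"
      by (simp add: analytic_at_imp_isCont isContD)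
    with H(2)[of z] have "R z = C"
      unfolding C by (intro tendsto_unique[of "at z"]) auto
    with False show ?thesis
      by (simp add: R_def field_simps)
  qed
  have "C \<noteq> 0"
    using theta1_not_identically_zero N_eq by (auto simp: N_def)
  show "theta1 z \<tau> = 0 \<longleftrightarrow> equivalent \<tau> z 0"
  proof
    assume "theta1 z \<tau> = 0"
    with N_eq[of z] \<open>C \<noteq> 0\<close> show "equivalent \<tau> z 0"
      by (intro zeroP) (simp add: N_def)
  qed (simp add: theta1_lattice[OF \<tau>] theta1_0[OF \<tau>])
  show "deriv (\<lambda>w. theta1 w \<tau>) 0 \<noteq> 0"
  proof
    assume *: "deriv (\<lambda>w. theta1 w \<tau>) 0 = 0"
    have "((\<lambda>w. theta1 w \<tau>) has_field_derivative 0) (at 0)"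
      using holomorphic_derivI[OF holomorphic_theta1[OF \<tau>], of 0] * by simp
    hence "(N has_field_derivative 0) (at 0)"
      unfolding N_def by (auto intro!: derivative_eq_intros simp: theta1_0[OF \<tau>])
    moreover have "N = (\<lambda>z. C * P z)"
      using N_eq by blast
    hence "(N has_field_derivative C * deriv P 0) (at 0)"
      using holomorphic_derivI[OF holP, of 0] by (auto intro!: derivative_eq_intros)
    ultimately show False
      using derP \<open>C \<noteq> 0\<close> DERIV_unique by fastforce
  qed
qed

end

section \<open>Residues of elliptic functions\<close>

text \<open>The logarithmic derivative \<open>Z\<close> of \<open>\<theta>\<^sub>1\<close> has a single simple pole modulo the lattice and is
  periodic up to an additive constant. Subtracting from \<open>f\<close> the combination of translates of \<open>Z\<close>
  with the same poles leaves an entire function whose \<open>\<pi>\<tau>\<close>-increment is a multiple of the sum of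
  the residues. This replaces integration along a period parallelogram.\<close>

lemma elliptic_residue_sum:
  assumes \<tau>: "Im \<tau> > 0" and "finite S"
    and inequivalent: "\<And>p s. p \<in> S \<Longrightarrow> s \<in> S \<Longrightarrow> p \<noteq> s \<Longrightarrow> \<not> equivalent \<tau> p s"
    and f_pi: "\<And>w. f (w + of_real pi) = f w"
    and f_tau: "\<And>w. f (w + of_real pi * \<tau>) = f w"
    and poles: "\<And>p. p \<in> S \<Longrightarrow> has_polar_part f (r p) p"
    and regular: "\<And>p. (\<And>s. s \<in> S \<Longrightarrow> \<not> equivalent \<tau> p s) \<Longrightarrow> has_polar_part f 0 p"
  shows "(\<Sum>p\<in>S. r p) = 0"
proof -
  define T where "T = (\<lambda>w. theta1 w \<tau>)"
  define Z where "Z = (\<lambda>w. deriv T w / T w)"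
  define g where "g = (\<lambda>w. f w - (\<Sum>s\<in>S. r s * Z (w - s)))"
  \<comment> \<open>Each translate of \<open>Z\<close> changes by \<open>- 2 * \<i>\<close> under pi
    tau; this is the resulting increment of \<open>g\<close>.\<close>
  define c where "c = 2 * \<i> * (\<Sum>s\<in>S. r s)"
  have holT: "T holomorphic_on UNIV"
    using holomorphic_theta1[OF \<tau>] by (simp add: T_def)
  have dT: "(T has_field_derivative deriv T w) (at w)" for w
    using holT by (intro holomorphic_derivI) auto
  have anT: "T analytic_on {p}" for p
    using holT by (auto simp: analytic_at)
  have T_eq_0: "T (w - s) = 0 \<longleftrightarrow> equivalent \<tau> w s" for w s
    using theta1_eq_0_iff[OF \<tau>, of "w - s"] by (simp add: T_def equivalent_def)
  have T_nonzero: "\<forall>\<^sub>F w in at p. T (w - s) \<noteq> 0" for p s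
    using eventually_theta1_nonzero[OF \<tau>, of "p - s"]
    by (simp add: T_def filtermap_at_shift [symmetric] eventually_filtermap)

  have Z_pi: "Z (w + of_real pi) = Z w" for w
  proof -
    have "((\<lambda>w. T (w + of_real pi)) has_field_derivative deriv T (w + of_real pi)) (at w)"
      using dT[of "w + of_real pi"] by (simp add: DERIV_shift)
    moreover have "((\<lambda>w. T (w + of_real pi)) has_field_derivative - deriv T w) (at w)"
      unfolding T_def theta1_pi[OF \<tau>] by (intro derivative_intros dT[unfolded T_def])
    ultimately have "deriv T (w + of_real pi) = - deriv T w"
      by (rule DERIV_unique)
    thus ?thesis
      by (simp add: Z_def T_def theta1_pi[OF \<tau>])
  qed
  \<comment> \<open>At a zero of \<open>T\<close>, division by zero makes both values of
    \<open>Z\<close> equal to 0 and the equation fails. Hence the increment of \<open>g\<close> is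
    obtained only on punctured neighbourhoods.\<close>
  have Z_tau: "Z (w + of_real pi * \<tau>) = Z w - 2 * \<i>" if "T w \<noteq> 0" for w
  proof -
    define e where "e = (\<lambda>w. nome_pow \<tau> (1/2) * exp (2 * \<i> * w))"
    define v where "v = w + of_real pi * \<tau>"
    have eT: "e u * T (u + of_real pi * \<tau>) = - T u" for u
      using theta1_pi_tau[OF \<tau>, of u] by (simp add: e_def T_def)
    have "((\<lambda>w. T (w + of_real pi * \<tau>)) has_field_derivative deriv T v) (at w)"
      using dT[of v] by (simp add: v_def DERIV_shift)
    moreover have "(e has_field_derivative 2 * \<i> * e w) (at w)"
      unfolding e_def by (auto intro!: derivative_eq_intros)
    ultimately have "((\<lambda>w. e w * T (w + of_real pi * \<tau>)) has_field_derivative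
        2 * \<i> * e w * T v + deriv T v * e w) (at w)"
      unfolding v_def by (intro DERIV_mult)
    moreover have "((\<lambda>w. e w * T (w + of_real pi * \<tau>)) has_field_derivative - deriv T w) (at w)"
      unfolding eT by (intro derivative_intros dT)
    ultimately have "2 * \<i> * e w * T v + deriv T v * e w = - deriv T w"
      by (rule DERIV_unique)
    moreover have "T w = - e w * T v"
      using eT[of w] by (simp add: v_def)
    ultimately have "Z w = (2 * \<i> * e w * T v + deriv T v * e w) / (e w * T v)"
      unfolding Z_def by (metis minus_divide_divide minus_minus mult_minus_left)
    moreover have "e w \<noteq> 0" "T v \<noteq> 0"
      using \<open>T w = - e w * T v\<close> that by auto
    ultimately have "Z w = 2 * \<i> + Z v"
      by (simp add: Z_def add_divide_distrib)
    thus ?thesis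
      by (simp add: v_def)
  qed
  have Z_polar: "has_polar_part (\<lambda>w. Z (w - s)) (if p = s then 1 else 0) p"
    if "p = s \<or> \<not> equivalent \<tau> p s" for p s
  proof -
    have "has_polar_part Z (if p = s then 1 else 0) (p - s)"
    proof (cases "p = s")
      case True
      thus ?thesis
        using has_polar_part_divide[OF analytic_deriv[OF anT] anT, of 0]
          deriv_theta1_0[OF \<tau>] theta1_0[OF \<tau>] by (simp add: Z_def T_def)
    next
      case False
      with that have "T (p - s) \<noteq> 0"
        by (simp add: T_eq_0)
      hence "Z analytic_on {p - s}"
        unfolding Z_def by (intro analytic_intros anT) auto
      with False show ?thesis
        by (simp add: has_polar_part_analytic)
    qed
    thus ?thesis
      using has_polar_part_shift[of Z _ p "- s"] by simp
  qed

  have g_pi: "g (w + of_real pi) = g w" for w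
  proof -
    have "Z (w + of_real pi - s) = Z (w - s)" for s
      using Z_pi[of "w - s"] by (simp add: algebra_simps)
    thus ?thesis
      by (simp add: g_def f_pi)
  qed
  have g_tau: "\<forall>\<^sub>F w in at p. g (w + of_real pi * \<tau>) = g w + c" for p
  proof -
    have "\<forall>\<^sub>F w in at p. \<forall>s\<in>S. T (w - s) \<noteq> 0"
      using \<open>finite S\<close> T_nonzero by (simp add: eventually_ball_finite)
    thus ?thesis
    proof eventually_elim
      case (elim w)
      have Z_s: "Z (w + of_real pi * \<tau> - s) = Z (w - s) - 2 * \<i>" if "s \<in> S" for s
        using Z_tau[of "w - s"] elim that by (simp add: algebra_simps)
      have "(\<Sum>s\<in>S. r s * Z (w + of_real pi * \<tau> - s)) = (\<Sum>s\<in>S. r s * Z (w - s) - 2 * \<i> * r s)"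
        by (intro sum.cong) (simp_all add: Z_s right_diff_distrib)
      also have "\<dots> = (\<Sum>s\<in>S. r s * Z (w - s)) - c"
        by (simp add: sum_subtractf c_def sum_distrib_left)
      finally show ?case
        by (simp add: g_def f_tau)
    qed
  qed
  have g_polar: "has_polar_part g (\<rho> - (\<Sum>s\<in>S. r s * (if p = s then 1 else 0))) p"
    if "has_polar_part f \<rho> p" "\<And>s. s \<in> S \<Longrightarrow> p = s \<or> \<not> equivalent \<tau> p s" for \<rho> p
    unfolding g_def
    by (intro has_polar_part_diff has_polar_part_sum has_polar_part_cmult Z_polar that)
  have "has_polar_part g 0 p" for p
  proof (cases "\<exists>s\<in>S. equivalent \<tau> p s")
    case True
    then obtain s where s: "s \<in> S" "equivalent \<tau> p s" by blast
    \<comment> \<open>Adding \<open>c\<close> preserves removability, so it suffices to look at the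
      representative \<open>s\<close>, where the residues \<open>r s\<close> cancel.\<close>
    have "has_polar_part g 0 p \<longleftrightarrow> has_polar_part g 0 s"
    proof (rule equivalent_induct[OF _ _ s(2)])
      fix p
      show "has_polar_part g 0 p \<longleftrightarrow> has_polar_part g 0 (p + of_real pi)"
        by (simp add: has_polar_part_shift g_pi)
      have const: "has_polar_part (\<lambda>w. g w + c) 0 p \<longleftrightarrow> has_polar_part g 0 p"
        using has_polar_part_add[of g 0 p "\<lambda>_. c" 0] has_polar_part_diff[of "\<lambda>w. g w + c" 0 p "\<lambda>_. c" 0]
          has_polar_part_analytic[of "\<lambda>_. c" p] by auto
      show "has_polar_part g 0 p \<longleftrightarrow> has_polar_part g 0 (p + of_real pi * \<tau>)"
        unfolding has_polar_part_shift has_polar_part_cong[OF g_tau] const ..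
    qed
    moreover have "(\<Sum>t\<in>S. r t * (if s = t then 1 else 0)) = r s"
      using s \<open>finite S\<close> by (simp add: if_distrib sum.delta' cong: if_cong)
    hence "has_polar_part g 0 s"
      using g_polar[OF poles[OF s(1)]] inequivalent s(1) by auto
    ultimately show ?thesis by simp
  next
    case False
    hence "p \<noteq> s" if "s \<in> S" for s
      using that equivalent_refl by blast
    hence "(\<Sum>s\<in>S. r s * (if p = s then 1 else 0)) = 0"
      by (intro sum.neutral) auto
    thus ?thesis
      using g_polar[OF regular, of p] False by auto
  qed
  then obtain H where H: "H holomorphic_on UNIV" "\<And>p. g \<midarrow>p\<rightarrow> H p"
    using entire_extension by blast
  \<comment> \<open>Passing to limits turns the relation near each point into one that holds
    everywhere.\<close>
  have H_shift: "H (z + d) = H z + e" if "\<forall>\<^sub>F w in at z. g (w + d) = g w + e" for z d e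
  proof (rule tendsto_unique)
    show "(\<lambda>w. g w + e) \<midarrow>z\<rightarrow> H z + e"
      by (intro tendsto_intros H)
    show "(\<lambda>w. g w + e) \<midarrow>z\<rightarrow> H (z + d)"
      using LIM_offset[OF H(2)[of "z + d"], of d] tendsto_cong[OF that] by simp
  qed simp
  have "c = 0"
    using quasi_periodic_entire[OF \<tau> H(1), of c] H_shift[of _ _ 0] H_shift g_pi g_tau by simp
  thus ?thesis
    by (simp add: c_def)
qed

text \<open>The point \<open>w\<close> keeps \<open>f\<close> from vanishing identically, so order 1
  gives a factorization \<open>h w * (w - z)\<close> near \<open>z\<close> with \<open>h z\<close>
  nonzero, and \<open>h z\<close> is the derivative.\<close>

lemma simple_zero_deriv_nonzero:
  assumes "f holomorphic_on UNIV" "f z = 0" "zorder f z = 1" "f w \<noteq> 0"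
  shows "deriv f z \<noteq> 0"
proof -
  define h where "h = zor_poly f z"
  have "\<exists>r>0. h holomorphic_on cball z r \<and> (\<forall>w\<in>cball z r. f w = h w * (w - z) ^ nat 1 \<and> h w \<noteq> 0)"
    using zorder_exist_zero[OF assms(1), of z] assms unfolding h_def by auto
  then obtain r where r: "r > 0" "h holomorphic_on cball z r"
    "\<And>w. w \<in> cball z r \<Longrightarrow> f w = h w * (w - z)" "h z \<noteq> 0"
    by (auto simp: less_imp_le)
  have "h holomorphic_on ball z r"
    using r(2) by (rule holomorphic_on_subset) auto
  hence "(h has_field_derivative deriv h z) (at z)"
    using r(1) by (intro holomorphic_derivI[of _ "ball z r"]) auto
  hence "((\<lambda>w. h w * (w - z)) has_field_derivative h z) (at z)"
    by (auto intro!: derivative_eq_intros)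
  moreover have "\<forall>\<^sub>F w in nhds z. f w = h w * (w - z)"
    using eventually_nhds_ball[OF r(1), of z] by eventually_elim (use r(3) in auto)
  ultimately have "(f has_field_derivative h z) (at z)"
    by (subst DERIV_cong_ev[OF refl _ refl])
  with r(4) show ?thesis
    by (simp add: DERIV_imp_deriv)
qed

section \<open>The theta function identity\<close>

theorem theorem1p10:
  fixes \<tau> y :: complex and n :: nat and F G :: "complex \<Rightarrow> complex" and a :: "nat \<Rightarrow> complex"
  assumes "Im \<tau> > 0"
    and "n \<ge> 1"
    and "F holomorphic_on UNIV" and "G holomorphic_on UNIV"
    and "\<not> (\<exists>z. F z = 0 \<and> G z = 0)"
    and "\<And>z. F z = F (z + of_real pi)"
    and "\<And>z. F z = nome_pow \<tau> (real n / 2) * exp (2 * \<i> * of_nat n * z + 2 * \<i> * y)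
                    * F (z + of_real pi * \<tau>)"
    and "\<And>z. G z = - G (z + of_real pi)"
    and "\<And>z. G z = - nome_pow \<tau> (real n / 2) * exp (2 * \<i> * of_nat n * z)
                    * G (z + of_real pi * \<tau>)"
    and "\<And>z. G z = 0 \<Longrightarrow> zorder G z = 1"
    and "inj_on a {1..n}"
    and "complete_inequivalent_zeros \<tau> G (a ` {1..n})"
  shows "\<forall>z. G z \<noteq> 0 \<longrightarrow>
           F z * theta3 y \<tau> / (deriv (\<lambda>w. theta1 w \<tau>) 0 * G z) =
           (\<Sum>k=1..n. F (a k) * theta3 (z + y - a k) \<tau> / (deriv G (a k) * theta1 (z - a k) \<tau>))"
proof (intro allI impI)
  fix z assume Gz: "G z \<noteq> 0"
  note \<tau> = assms(1) and holF = assms(3) and holG = assms(4)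
  define A where "A = a ` {1..n}"
  define N where "N = (\<lambda>w. F w * theta3 (z + y - w) \<tau>)"
  define D where "D = (\<lambda>w. theta1 (z - w) \<tau>)"
  define f where "f = (\<lambda>w. N w / (G w * D w))"
  \<comment> \<open>The variable enters \<open>D\<close> as \<open>z - w\<close>, so its derivative
    at \<open>z\<close> is minus theta_1'(0); this is the sign of the residue at
    \<open>z\<close>.\<close>
  define r where "r = (\<lambda>p. if p = z then - (N z / (G z * deriv (\<lambda>w. theta1 w \<tau>) 0))
                             else N p / (deriv G p * D p))"
  have zerosA: "\<And>p. p \<in> A \<Longrightarrow> G p = 0"
      "\<And>p s. p \<in> A \<Longrightarrow> s \<in> A \<Longrightarrow> p \<noteq> s \<Longrightarrow> \<not> equivalent \<tau> p s"
      "\<And>p. G p = 0 \<Longrightarrow> \<exists>s\<in>A. equivalent \<tau> p s"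
    using assms(12) unfolding complete_inequivalent_zeros_def A_def by blast+
  have G_lattice: "G p = 0 \<longleftrightarrow> G s = 0" if "equivalent \<tau> p s" for p s
  proof (rule equivalent_induct[OF _ _ that])
    fix p
    show "G p = 0 \<longleftrightarrow> G (p + of_real pi) = 0"
      by (subst assms(8)) simp
    show "G p = 0 \<longleftrightarrow> G (p + of_real pi * \<tau>) = 0"
      by (subst assms(9)) simp
  qed
  have D_eq_0: "D w = 0 \<longleftrightarrow> equivalent \<tau> z w" for w
    using theta1_eq_0_iff[OF \<tau>, of "z - w"] by (simp add: D_def equivalent_def)
  have holN: "N holomorphic_on UNIV"
    unfolding N_def
    by (intro holomorphic_intros holF holomorphic_on_compose_gen[OF _ holomorphic_theta3[OF \<tau>], unfolded o_def]) auto
  have holD: "D holomorphic_on UNIV"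
    unfolding D_def
    by (intro holomorphic_intros holomorphic_on_compose_gen[OF _ holomorphic_theta1[OF \<tau>], unfolded o_def]) auto
  have an: "h analytic_on {p}" if "h holomorphic_on UNIV" for h :: "complex \<Rightarrow> complex" and p
    using that by (auto simp: analytic_at)
  note analytic = an[OF holN] an[OF holG] an[OF holD]
  have derD: "deriv D z = - deriv (\<lambda>w. theta1 w \<tau>) 0"
  proof (rule DERIV_imp_deriv)
    have "((\<lambda>w. theta1 w \<tau>) has_field_derivative deriv (\<lambda>w. theta1 w \<tau>) 0) (at (z - z))"
      using holomorphic_derivI[OF holomorphic_theta1[OF \<tau>], of 0] by simp
    moreover have "((\<lambda>w. z - w) has_field_derivative - 1) (at z)"
      by (auto intro!: derivative_eq_intros)
    ultimately show "(D has_field_derivative - deriv (\<lambda>w. theta1 w \<tau>) 0) (at z)"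
      unfolding D_def
      using DERIV_chain2[where f = "\<lambda>w. theta1 w \<tau>" and g = "\<lambda>w. z - w" and x = z] by fastforce
  qed

  have "(\<Sum>p\<in>insert z A. r p) = 0"
  proof (rule elliptic_residue_sum[OF \<tau>, of "insert z A" f])
    show "finite (insert z A)"
      by (simp add: A_def)
    show "\<not> equivalent \<tau> p s" if "p \<in> insert z A" "s \<in> insert z A" "p \<noteq> s" for p s
      \<comment> \<open>The zeros of \<open>G\<close> form full lattice classes and
        \<open>G z\<close> is nonzero, so \<open>z\<close> is inequivalent to every point of
        \<open>A\<close>.\<close>
      using that zerosA Gz G_lattice by (metis insertE)
    show "f (w + of_real pi) = f w" for w
    proof -
      have "z + y - w = z + y - (w + of_real pi) + of_real pi" "z - w = z - (w + of_real pi) + of_real pi"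
        by simp_all
      hence "theta3 (z + y - w) \<tau> = theta3 (z + y - (w + of_real pi)) \<tau>"
          "theta1 (z - w) \<tau> = - theta1 (z - (w + of_real pi)) \<tau>"
        by (metis theta3_pi[OF \<tau>], metis theta1_pi[OF \<tau>])
      moreover have "G (w + of_real pi) = - G w"
        by (subst assms(8)[of w]) simp
      ultimately show ?thesis
        by (simp add: f_def N_def D_def assms(6)[of w, symmetric])
    qed
    show "f (w + of_real pi * \<tau>) = f w" for w
    proof -
      define v where "v = w + of_real pi * \<tau>"
      \<comment> \<open>\<open>\<kappa>\<close> and \<open>\<mu>\<close> are, up to sign, the
        multipliers of \<open>G\<close> and \<open>D\<close>. Those of \<open>F\<close> and theta_3
        carry an extra \<open>exp (2 * \<i> * y)\<close>; it cancels because the theta argument runs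
        backwards.\<close>
      define \<kappa> where "\<kappa> = nome_pow \<tau> (real n / 2) * exp (2 * \<i> * of_nat n * w)"
      define \<mu> where "\<mu> = nome_pow \<tau> (1 / 2) * exp (2 * \<i> * (z - v))"
      have [simp]: "\<kappa> \<noteq> 0" "\<mu> \<noteq> 0"
        by (auto simp: \<kappa>_def \<mu>_def)
      have 1: "F w = \<kappa> * exp (2 * \<i> * y) * F v"
        by (subst assms(7)) (simp add: \<kappa>_def v_def exp_add)
      have 2: "G w = - \<kappa> * G v"
        by (subst assms(9)) (simp add: \<kappa>_def v_def)
      have 3: "theta3 (z + y - v) \<tau> = \<mu> * exp (2 * \<i> * y) * theta3 (z + y - w) \<tau>"
      proof -
        have "exp (2 * \<i> * (z + y - v)) = exp (2 * \<i> * (z - v)) * exp (2 * \<i> * y)"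
          unfolding exp_add [symmetric] by (simp add: algebra_simps)
        moreover have "z + y - v + of_real pi * \<tau> = z + y - w"
          by (simp add: v_def)
        ultimately show ?thesis
          using theta3_pi_tau[OF \<tau>, of "z + y - v"] by (simp only: \<mu>_def mult.assoc)
      qed
      have zv: "z - v + of_real pi * \<tau> = z - w"
        by (simp add: v_def)
      have 4: "D v = - \<mu> * D w"
        using theta1_pi_tau[OF \<tau>, of "z - v", unfolded zv] by (simp add: \<mu>_def D_def)
      have "f w = (\<kappa> * (exp (2 * \<i> * y) * F v * theta3 (z + y - w) \<tau>)) / (\<kappa> * (- G v * D w))"
        by (simp add: f_def N_def 1 2)
      also have "\<dots> = (exp (2 * \<i> * y) * F v * theta3 (z + y - w) \<tau>) / (- G v * D w)"
        by simp
      also have "\<dots> = (\<mu> * (exp (2 * \<i> * y) * F v * theta3 (z + y - w) \<tau>)) / (\<mu> * (- G v * D w))"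
        by simp
      also have "\<dots> = f v"
        by (simp add: f_def N_def 3 4 mult_ac)
      finally show ?thesis
        by (simp add: v_def)
    qed
    show "has_polar_part f (r p) p" if "p \<in> insert z A" for p
    proof (cases "p = z")
      case True
      \<comment> \<open>At \<open>z\<close> the simple zero comes from \<open>D\<close> and
        \<open>G\<close> goes into the numerator; at the points of \<open>A\<close> the roles are
        exchanged.\<close>
      have "has_polar_part (\<lambda>w. (N w / G w) / D w) ((N z / G z) / deriv D z) z"
        by (intro has_polar_part_divide analytic_intros analytic)
           (use Gz D_eq_0 equivalent_refl deriv_theta1_0[OF \<tau>] in \<open>auto simp: derD\<close>)
      with True show ?thesis
        by (simp add: f_def r_def derD)
    next
      case False
      with that have p: "p \<in> A" "G p = 0"
        using zerosA by auto
      hence "D p \<noteq> 0"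
        using Gz G_lattice by (auto simp: D_eq_0)
      have "deriv G p \<noteq> 0"
        using simple_zero_deriv_nonzero[OF holG p(2) assms(10)[OF p(2)] Gz] .
      have "has_polar_part (\<lambda>w. (N w / D w) / G w) ((N p / D p) / deriv G p) p"
        by (intro has_polar_part_divide analytic_intros analytic)
           (use p \<open>D p \<noteq> 0\<close> \<open>deriv G p \<noteq> 0\<close> in auto)
      with False show ?thesis
        by (simp add: f_def r_def mult.commute)
    qed
    show "has_polar_part f 0 p" if "\<And>s. s \<in> insert z A \<Longrightarrow> \<not> equivalent \<tau> p s" for p
    proof -
      have "G p \<noteq> 0" "D p \<noteq> 0"
        using that zerosA(3) equivalent_sym D_eq_0 by (blast intro: insertI1 insertI2)+
      thus ?thesis
        unfolding f_def by (intro has_polar_part_analytic analytic_intros analytic) auto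
    qed
  qed
  moreover have "z \<notin> A"
    using zerosA Gz by blast
  moreover have "finite A"
    by (simp add: A_def)
  ultimately have "(\<Sum>p\<in>A. r p) = - r z"
    by (simp add: add_eq_0_iff)
  also have "(\<Sum>p\<in>A. r p) = (\<Sum>p\<in>A. N p / (deriv G p * D p))"
    using \<open>z \<notin> A\<close> by (intro sum.cong) (auto simp: r_def)
  also have "\<dots> = (\<Sum>k=1..n. N (a k) / (deriv G (a k) * D (a k)))"
    unfolding A_def by (subst sum.reindex[OF assms(11)]) simp
  finally show "F z * theta3 y \<tau> / (deriv (\<lambda>w. theta1 w \<tau>) 0 * G z) =
       (\<Sum>k=1..n. F (a k) * theta3 (z + y - a k) \<tau> / (deriv G (a k) * theta1 (z - a k) \<tau>))"
    by (simp add: N_def D_def r_def mult.commute)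
qed

end
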